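(* Let $k\ge 1$ be arbitrary. Let $\Delta$ be a finitely generated group, for $1\le i\le k$ let $\rho_i:\Delta\to \mathrm{SO}^\circ(n_i,1)$ ($n_i\ge 2$) be a convex cocompact faithful representation with Zariski dense image, such that no two of the $\rho_i$ are conjugate to each other, and let $\Gamma=\{(\rho_1(\sigma),\dots,\rho_k(\sigma)):\sigma\in\Delta\}$. Let $u=(u_1,\dots,u_k)$ be a unit vector in the interior of the limit cone $\mathcal L$ of $\Gamma$, and put $m_u=\min_{1\le i\le k}u_i$ and $\delta_u=\psi_\Gamma(u)$. Then the Hausdorff dimension of the $u$-directional limit set $\Lambda_u$ satisfies $$\dim\Lambda_u\le\frac{\delta_u}{m_u}.$$
   Context: For each $i$, $X_i=\mathbb H^{n_i}$ is hyperbolic space of constant curvature $-1$ with distance $d_i$, whose geometric boundary is identified with $\mathbb S^{n_i-1}$, and $o_i\in X_i$ is a fixed basepoint. $X=\prod_i X_i$ carries $d((x_i),(y_i))=\sqrt{\sum_i d_i(x_i,y_i)^2}$, $o=(o_1,\dots,o_k)$, $G=\prod_i\mathrm{SO}^\circ(n_i,1)$, $\mathcal F=\prod_i\mathbb S^{n_i-1}$. $\Gamma$ is assumed Zariski dense in $G$ (this is what the assumption on the $\rho_i$ ensures). Hausdorff dimension of subsets of $\mathcal F$ is with respect to the Riemannian product of the spherical metrics. Cartan projection: $\mu(g)=(d_1(g_1o_1,o_1),\dots,d_k(g_ko_k,o_k))\in\mathbb R^k_{\ge0}$; $\|\cdot\|$ is the Euclidean norm on $\mathbb R^k$, so $\|\mu(g)\|=d(go,o)$.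 Limit cone: $\mathcal L=\{\lim_{j\to\infty}t_j\mu(\gamma_j): t_j\to0,\ t_j>0,\ \gamma_j\in\Gamma\}$. Growth indicator function $\psi_\Gamma:\mathbb R^k\to\mathbb R\cup\{-\infty\}$: for an open cone $\mathcal C\subset\mathbb R^k$ let $\tau_{\mathcal C}$ be the abscissa of convergence of $\sum_{\gamma\in\Gamma,\ \mu(\gamma)\in\mathcal C}e^{-s\,d(\gamma o,o)}$; for $u\ne0$, $\psi_\Gamma(u)=\|u\|\inf_{\mathcal C\ni u}\tau_{\mathcal C}$, the infimum over all open cones containing $u$; $\psi_\Gamma(0)=0$. Directional limit set: for $u\in\mathbb R^k_{>0}$, $\Lambda_u$ is the set of $\xi=(\xi_1,\dots,\xi_k)\in\mathcal F$ with $\liminf_{t\to+\infty}d\big((\xi_1(tu_1),\dots,\xi_k(tu_k)),\Gamma o\big)<\infty$, where $\{\xi_i(t):t\ge0\}$ is the unit speed geodesic ray in $X_i$ from $o_i$ to $\xi_i$. For this class of $\Gamma$ one has $\mathcal L\subset\mathbb R^k_{>0}\cup\{0\}$. *)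

theory Defs
  imports
    "HOL-Analysis.Analysis"
    "HOL-Algebra.Generated_Groups"
    "Jordan_Normal_Form.Determinant"
begin

text \<open>
  Both \<^theory>\<open>HOL-Analysis.Finite_Cartesian_Product\<close> and
  \<^theory>\<open>Jordan_Normal_Form.Matrix\<close> provide vectors. Objects in \<open>\<real>\<^sup>k\<close> are of type
  \<open>real ^ 'k\<close> with \<open>'k\<close> the finite index type of the factors. The dimensions \<open>n i\<close> vary with
  \<open>i\<close>, so points of the individual factors and matrices are those of Jordan_Normal_Form, with
  components written \<open>x $v i\<close>.
\<close>

no_notation Matrix.vec_index (infixl "$" 100)
notation Matrix.vec_index (infixl "$v" 100)

section \<open>Hyperbolic space\<close>

text \<open>
  Hyperboloid model; coordinate 0 is the time coordinate.
\<close>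

definition lorentz_form :: "real Matrix.vec \<Rightarrow> real Matrix.vec \<Rightarrow> real" where
  "lorentz_form x y = (\<Sum>i\<in>{1..<dim_vec x}. x $v i * y $v i) - x $v 0 * y $v 0"

definition hyp_space :: "nat \<Rightarrow> real Matrix.vec set" where
  "hyp_space n = {x \<in> carrier_vec (n + 1). lorentz_form x x = -1 \<and> x $v 0 > 0}"

definition hyp_dist :: "real Matrix.vec \<Rightarrow> real Matrix.vec \<Rightarrow> real" where
  "hyp_dist x y = arcosh (- lorentz_form x y)"

definition hyp_topology :: "nat \<Rightarrow> real Matrix.vec topology" where
  "hyp_topology n = Metric_space.mtopology (hyp_space n) hyp_dist"

text \<open>\<open>bdry_sphere n\<close> is the unit sphere of \<open>\<real>\<^sup>n\<close>, i.e. \<open>\<S>\<^sup>n\<^sup>-\<^sup>1\<close>, the boundary of \<open>\<H>\<^sup>n\<close>.\<close>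

definition bdry_sphere :: "nat \<Rightarrow> real Matrix.vec set" where
  "bdry_sphere n = {\<xi> \<in> carrier_vec n. scalar_prod \<xi> \<xi> = 1}"

definition sphere_dist :: "real Matrix.vec \<Rightarrow> real Matrix.vec \<Rightarrow> real" where
  "sphere_dist \<xi> \<eta> = arccos (scalar_prod \<xi> \<eta>)"

text \<open>
  A boundary point \<open>\<xi>\<close> is identified with the isotropic line through \<open>(1, \<xi>)\<close>: points of the
  hyperboloid tend to \<open>\<xi>\<close> iff their projections \<open>x\<^sub>i / x\<^sub>0\<close> to the unit ball (the Klein model) do.
\<close>

definition tends_to_bdry ::
  "nat \<Rightarrow> ('b \<Rightarrow> real Matrix.vec) \<Rightarrow> real Matrix.vec \<Rightarrow> 'b filter \<Rightarrow> bool" where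
  "tends_to_bdry n x \<xi> F \<longleftrightarrow>
     (\<forall>i<n. ((\<lambda>t. x t $v (i + 1) / x t $v 0) \<longlongrightarrow> \<xi> $v i) F)"

definition geodesic_ray ::
  "nat \<Rightarrow> real Matrix.vec \<Rightarrow> real Matrix.vec \<Rightarrow> (real \<Rightarrow> real Matrix.vec) \<Rightarrow> bool" where
  "geodesic_ray n p \<xi> r \<longleftrightarrow>
     r 0 = p \<and> (\<forall>t\<ge>0. r t \<in> hyp_space n) \<and>
     (\<forall>s\<ge>0. \<forall>t\<ge>0. hyp_dist (r s) (r t) = \<bar>s - t\<bar>) \<and>
     tends_to_bdry n r \<xi> at_top"

definition geodesic_line ::
  "nat \<Rightarrow> real Matrix.vec \<Rightarrow> real Matrix.vec \<Rightarrow> (real \<Rightarrow> real Matrix.vec) \<Rightarrow> bool" where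
  "geodesic_line n \<xi> \<eta> r \<longleftrightarrow>
     (\<forall>t. r t \<in> hyp_space n) \<and> (\<forall>s t. hyp_dist (r s) (r t) = \<bar>s - t\<bar>) \<and>
     tends_to_bdry n r \<xi> at_bot \<and> tends_to_bdry n r \<eta> at_top"

text \<open>The geodesic segment joining \<open>x\<close> and \<open>y\<close> is the set of points between \<open>x\<close> and \<open>y\<close>.\<close>

definition hyp_convex :: "nat \<Rightarrow> real Matrix.vec set \<Rightarrow> bool" where
  "hyp_convex n C \<longleftrightarrow> C \<subseteq> hyp_space n \<and>
     (\<forall>x\<in>C. \<forall>y\<in>C. {z \<in> hyp_space n. hyp_dist x z + hyp_dist z y = hyp_dist x y} \<subseteq> C)"

section \<open>The group \<open>SO\<^sup>\<circ>(n,1)\<close>\<close>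

definition SO_set :: "nat \<Rightarrow> real mat set" where
  "SO_set n = {A \<in> carrier_mat (n + 1) (n + 1). Determinant.det A = 1 \<and>
     (\<forall>x\<in>carrier_vec (n + 1). \<forall>y\<in>carrier_vec (n + 1).
        lorentz_form (A *\<^sub>v x) (A *\<^sub>v y) = lorentz_form x y)}"

text \<open>
  The usual topology on \<open>m \<times> m\<close> matrices, pulled back from the product topology along the map
  to the entries.
\<close>

definition mat_topology :: "nat \<Rightarrow> real mat topology" where
  "mat_topology m = pullback_topology (carrier_mat m m)
     (\<lambda>A (i, j). if i < m \<and> j < m then A $$ (i, j) else 0) euclidean"

definition SO_circ :: "nat \<Rightarrow> real mat monoid" where
  "SO_circ n = \<lparr>carrier = {A. connected_component_of
       (subtopology (mat_topology (n + 1)) (SO_set n)) (1\<^sub>m (n + 1)) A},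
     mult = (*), one = 1\<^sub>m (n + 1)\<rparr>"

inductive_set poly_fun :: "nat \<Rightarrow> (real mat \<Rightarrow> real) set" for m where
  const: "(\<lambda>_. c) \<in> poly_fun m"
| entry: "i < m \<Longrightarrow> j < m \<Longrightarrow> (\<lambda>A. A $$ (i, j)) \<in> poly_fun m"
| add: "p \<in> poly_fun m \<Longrightarrow> q \<in> poly_fun m \<Longrightarrow> (\<lambda>A. p A + q A) \<in> poly_fun m"
| mult: "p \<in> poly_fun m \<Longrightarrow> q \<in> poly_fun m \<Longrightarrow> (\<lambda>A. p A * q A) \<in> poly_fun m"

definition zariski_closed :: "nat \<Rightarrow> real mat set \<Rightarrow> bool" where
  "zariski_closed m Z \<longleftrightarrow>
     (\<exists>P \<subseteq> poly_fun m. Z = {A \<in> carrier_mat m m. \<forall>p\<in>P. p A = 0})"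

definition zariski_dense_SO :: "nat \<Rightarrow> real mat set \<Rightarrow> bool" where
  "zariski_dense_SO n S \<longleftrightarrow> S \<subseteq> carrier (SO_circ n) \<and>
     (\<forall>Z. zariski_closed (n + 1) Z \<and> S \<subseteq> Z \<longrightarrow> carrier (SO_circ n) \<subseteq> Z)"

section \<open>Convex cocompactness\<close>

definition limit_set :: "nat \<Rightarrow> real mat set \<Rightarrow> real Matrix.vec set" where
  "limit_set n S = {\<xi> \<in> bdry_sphere n. \<exists>x\<in>hyp_space n. \<exists>g :: nat \<Rightarrow> real mat.
     (\<forall>j. g j \<in> S) \<and> tends_to_bdry n (\<lambda>j. g j *\<^sub>v x) \<xi> sequentially}"

definition limit_hull :: "nat \<Rightarrow> real mat set \<Rightarrow> real Matrix.vec set" where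
  "limit_hull n S = \<Inter>{C. closedin (hyp_topology n) C \<and> hyp_convex n C \<and>
     (\<forall>\<xi>\<in>limit_set n S. \<forall>\<eta>\<in>limit_set n S. \<forall>r. geodesic_line n \<xi> \<eta> r \<longrightarrow> range r \<subseteq> C)}"

text \<open>
  A discrete subgroup is convex cocompact if it acts cocompactly on the hull of its limit set,
  i.e. if its convex core is compact.
\<close>

definition convex_cocompact :: "nat \<Rightarrow> real mat set \<Rightarrow> bool" where
  "convex_cocompact n S \<longleftrightarrow>
     subgroup S (SO_circ n) \<and>
     subtopology (mat_topology (n + 1)) S = discrete_topology S \<and>
     (\<exists>K. compactin (hyp_topology n) K \<and> K \<subseteq> limit_hull n S \<and>
        limit_hull n S = (\<Union>g\<in>S. (\<lambda>x. g *\<^sub>v x) ` K))"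

section \<open>Representations and self-joinings\<close>

definition finitely_generated_group :: "('a, 'b) monoid_scheme \<Rightarrow> bool" where
  "finitely_generated_group D \<longleftrightarrow> group D \<and>
     (\<exists>S. finite S \<and> S \<subseteq> carrier D \<and> generate D S = carrier D)"

definition conjugate_reps ::
  "('a, 'b) monoid_scheme \<Rightarrow> nat \<Rightarrow> ('a \<Rightarrow> real mat) \<Rightarrow> nat \<Rightarrow> ('a \<Rightarrow> real mat) \<Rightarrow> bool" where
  "conjugate_reps D n \<rho> m \<rho>' \<longleftrightarrow> n = m \<and>
     (\<exists>g\<in>carrier (SO_circ n). \<forall>\<sigma>\<in>carrier D.
        \<rho>' \<sigma> = g \<otimes>\<^bsub>SO_circ n\<^esub> \<rho> \<sigma> \<otimes>\<^bsub>SO_circ n\<^esub> inv\<^bsub>SO_circ n\<^esub> g)"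

definition self_joining ::
  "('a, 'b) monoid_scheme \<Rightarrow> ('k \<Rightarrow> 'a \<Rightarrow> real mat) \<Rightarrow> ('k \<Rightarrow> real mat) set" where
  "self_joining D \<rho> = (\<lambda>\<sigma> i. \<rho> i \<sigma>) ` carrier D"

section \<open>The product space\<close>

text \<open>
  Points of \<open>X = \<Prod>\<^sub>i \<H>\<^sup>n\<^sup>i\<close>, of \<open>\<F> = \<Prod>\<^sub>i \<S>\<^sup>n\<^sup>i\<^sup>-\<^sup>1\<close> and elements of \<open>G\<close> are families indexed by the
  finite type \<open>'k\<close>.
\<close>

type_synonym 'k point = "'k \<Rightarrow> real Matrix.vec"

definition prod_act :: "('k \<Rightarrow> real mat) \<Rightarrow> 'k point \<Rightarrow> 'k point" where
  "prod_act g x = (\<lambda>i. g i *\<^sub>v x i)"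

definition prod_dist :: "'k::finite point \<Rightarrow> 'k point \<Rightarrow> real" where
  "prod_dist x y = sqrt (\<Sum>i\<in>UNIV. (hyp_dist (x i) (y i))\<^sup>2)"

definition furstenberg_bdry :: "('k \<Rightarrow> nat) \<Rightarrow> 'k point set" where
  "furstenberg_bdry n = {\<xi>. \<forall>i. \<xi> i \<in> bdry_sphere (n i)}"

text \<open>The distance function of the Riemannian product of the spherical metrics.\<close>

definition bdry_dist :: "'k::finite point \<Rightarrow> 'k point \<Rightarrow> real" where
  "bdry_dist \<xi> \<eta> = sqrt (\<Sum>i\<in>UNIV. (sphere_dist (\<xi> i) (\<eta> i))\<^sup>2)"

definition cartan_proj :: "'k::finite point \<Rightarrow> ('k \<Rightarrow> real mat) \<Rightarrow> real ^ 'k" where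
  "cartan_proj p g = (\<chi> i. hyp_dist (g i *\<^sub>v p i) (p i))"

definition limit_cone :: "'k::finite point \<Rightarrow> ('k \<Rightarrow> real mat) set \<Rightarrow> (real ^ 'k) set" where
  "limit_cone p \<Gamma> = {v. \<exists>(t :: nat \<Rightarrow> real) g.
     (\<forall>j. t j > 0 \<and> g j \<in> \<Gamma>) \<and> t \<longlonglongrightarrow> 0 \<and> (\<lambda>j. t j *\<^sub>R cartan_proj p (g j)) \<longlonglongrightarrow> v}"

section \<open>The growth indicator function\<close>

text \<open>The library's \<^const>\<open>cone\<close> always contains 0 when nonempty, so it is not usable for open cones.\<close>

definition open_cone :: "('v::real_normed_vector) set \<Rightarrow> bool" where
  "open_cone C \<longleftrightarrow> open C \<and> (\<forall>x\<in>C. \<forall>c>0. c *\<^sub>R x \<in> C)"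

definition cone_exponent ::
  "'k::finite point \<Rightarrow> ('k \<Rightarrow> real mat) set \<Rightarrow> (real ^ 'k) set \<Rightarrow> ereal" where
  "cone_exponent p \<Gamma> C = Inf {ereal s | s.
     (\<lambda>g. exp (- s * prod_dist (prod_act g p) p)) summable_on {g \<in> \<Gamma>. cartan_proj p g \<in> C}}"

definition growth_indicator ::
  "'k::finite point \<Rightarrow> ('k \<Rightarrow> real mat) set \<Rightarrow> real ^ 'k \<Rightarrow> ereal" where
  "growth_indicator p \<Gamma> u = (if u = 0 then 0
     else ereal (norm u) * (INF C\<in>{C. open_cone C \<and> u \<in> C}. cone_exponent p \<Gamma> C))"

section \<open>Directional limit sets\<close>

text \<open>The rays \<open>r i\<close> are uniquely determined on \<open>[0, \<infinity>)\<close> by \<open>p i\<close> and \<open>\<xi> i\<close>.\<close>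

definition directional_limit_set ::
  "('k::finite \<Rightarrow> nat) \<Rightarrow> 'k point \<Rightarrow> ('k \<Rightarrow> real mat) set \<Rightarrow> real ^ 'k \<Rightarrow> 'k point set" where
  "directional_limit_set n p \<Gamma> u = {\<xi> \<in> furstenberg_bdry n.
     \<exists>r. (\<forall>i. geodesic_ray (n i) (p i) (\<xi> i) (r i)) \<and>
       Liminf at_top (\<lambda>t::real. INF g\<in>\<Gamma>.
         ereal (prod_dist (\<lambda>i. r i (t * u $ i)) (prod_act g p))) < \<infinity>}"

section \<open>Hausdorff dimension\<close>

text \<open>Only used for sets \<open>U\<close> that are bounded with respect to \<open>d\<close>.\<close>

definition set_diam :: "('x \<Rightarrow> 'x \<Rightarrow> real) \<Rightarrow> 'x set \<Rightarrow> real" where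
  "set_diam d U = (if U = {} then 0 else Sup {d x y | x y. x \<in> U \<and> y \<in> U})"

definition hausdorff_premeasure ::
  "'x set \<Rightarrow> ('x \<Rightarrow> 'x \<Rightarrow> real) \<Rightarrow> real \<Rightarrow> real \<Rightarrow> 'x set \<Rightarrow> ennreal" where
  "hausdorff_premeasure M d s \<epsilon> A =
     (INF U\<in>{U :: nat \<Rightarrow> 'x set. A \<subseteq> (\<Union>j. U j) \<and>
        (\<forall>j. U j \<subseteq> M \<and> (\<forall>x\<in>U j. \<forall>y\<in>U j. d x y \<le> \<epsilon>))}.
      \<Sum>j. ennreal (set_diam d (U j) powr s))"

definition hausdorff_measure ::
  "'x set \<Rightarrow> ('x \<Rightarrow> 'x \<Rightarrow> real) \<Rightarrow> real \<Rightarrow> 'x set \<Rightarrow> ennreal" where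
  "hausdorff_measure M d s A = (SUP \<epsilon>\<in>{0<..}. hausdorff_premeasure M d s \<epsilon> A)"

text \<open>
  The infimum is taken over \<open>s > 0\<close> because \<open>0 powr 0 = 0\<close>; including \<open>s = 0\<close> (the counting
  measure) would not change its value, as the vanishing of the measure is monotone in \<open>s\<close>.
\<close>

definition hausdorff_dim :: "'x set \<Rightarrow> ('x \<Rightarrow> 'x \<Rightarrow> real) \<Rightarrow> 'x set \<Rightarrow> ereal" where
  "hausdorff_dim M d A = Inf {ereal s | s. s > 0 \<and> hausdorff_measure M d s A = 0}"

end

theory Submission
  imports Defs
begin

text \<open>
  The bound is a covering argument. If \<open>\<xi>\<close> lies in the directional limit set, the flat ray from the
  basepoint to \<open>\<xi>\<close> with velocity \<open>u\<close> passes at arbitrarily late times \<open>t\<close> within a bounded distance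
  of orbit points \<open>\<gamma> p\<close>. The Cartan projection \<open>\<mu>(\<gamma>)\<close> of such a \<open>\<gamma>\<close> is within bounded distance of
  \<open>t u\<close>, so it eventually lies in any given open cone around \<open>u\<close>, and \<open>\<xi>\<close> lies in the shadow of a
  ball around \<open>\<gamma> p\<close> seen from \<open>p\<close>. In factor \<open>i\<close> this ball is at distance about \<open>t u\<^sub>i\<close>, and its
  shadow has angular size of order \<open>exp(- t u\<^sub>i)\<close>. The shadow in the product therefore has diameter of
  order \<open>exp(- m\<^sub>u \<parallel>\<mu>(\<gamma>)\<parallel>)\<close>, the slowest factor being decisive (\<open>flat_shadow_diam\<close>), and
  the sum of the \<open>s\<close>-th powers of the diameters over the elements in a cone is bounded by a multiple of
  a Poincare series with exponent \<open>s m\<^sub>u\<close>. It converges for a small enough cone when \<open>s m\<^sub>u > \<psi>\<^sub>\<Gamma>(u)\<close>. As every point of the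
  limit set lies in infinitely many shadows (\<open>directional_limit_in_flat_shadows\<close>), its
  \<open>s\<close>-dimensional measure is then zero (\<open>hausdorff_null_if_limsup_cover\<close>).

  The size of shadows is computed in the hyperboloid model. Cauchy--Schwarz on the orthogonal
  complement of a timelike vector gives the triangle inequality, the Lipschitz property of Busemann
  functions and the comparison of Busemann functions with angles on the boundary; together they give
  \<open>sphere_dist_le_of_rays_near\<close>.

  The group enters in two ways. Its elements map the hyperboloid sheets to themselves because they lie
  in the identity component (\<open>SO_circ_preserves_hyp_space\<close>). And \<open>u\<close> is an interior direction of the
  limit cone, so that all \<open>u\<^sub>i\<close> are positive (\<open>interior_orthant_pos\<close>) and every cone around \<open>u\<close>
  contains infinitely many Cartan projections (\<open>infinite_in_open_cone\<close>), which makes the growth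
  indicator nonnegative at \<open>u\<close>.
\<close>

section \<open>Null sets from limsup covers\<close>

lemma summable_on_small_tail:
  fixes f :: "'i \<Rightarrow> real"
  assumes "f summable_on I" and "\<And>i. i \<in> I \<Longrightarrow> f i \<ge> 0" and "\<eta> > 0"
  obtains F where "finite F" "F \<subseteq> I"
    "\<And>G. finite G \<Longrightarrow> G \<subseteq> I - F \<Longrightarrow> sum f G \<le> \<eta>"
proof -
  obtain F where F: "finite F" "F \<subseteq> I" "dist (sum f F) (infsum f I) \<le> \<eta>"
    using infsum_finite_approximation[OF assms(1,3)] by blast
  have "sum f G \<le> \<eta>" if G: "finite G" "G \<subseteq> I - F" for G
  proof -
    have "sum f F + sum f G = sum f (F \<union> G)"
      using F(1) G by (subst sum.union_disjoint) auto
    also have "\<dots> \<le> infsum f I"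
      by (rule finite_sum_le_infsum) (use assms F G in auto)
    finally show ?thesis using F(3) by (auto simp: dist_real_def)
  qed
  then show thesis using that F(1,2) by blast
qed

lemma set_diam_bounds:
  assumes nonneg: "\<And>x y. d x y \<ge> 0" and "w \<ge> 0" and bound: "\<And>x y. x \<in> U \<Longrightarrow> y \<in> U \<Longrightarrow> d x y \<le> w"
  shows "0 \<le> set_diam d U" "set_diam d U \<le> w"
proof -
  have "0 \<le> set_diam d U \<and> set_diam d U \<le> w"
  proof (cases "U = {}")
    case False
    then obtain a where a: "a \<in> U" by blast
    have "0 \<le> d a a" by (rule nonneg)
    also have "d a a \<le> Sup {d x y | x y. x \<in> U \<and> y \<in> U}"
      by (rule cSup_upper) (use a bound in \<open>auto intro!: bdd_aboveI[where M=w]\<close>)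
    finally have "0 \<le> Sup {d x y | x y. x \<in> U \<and> y \<in> U}" .
    moreover have "Sup {d x y | x y. x \<in> U \<and> y \<in> U} \<le> w"
      by (rule cSup_least) (use a bound in auto)
    ultimately show ?thesis using False by (simp add: set_diam_def)
  qed (use assms in \<open>simp add: set_diam_def\<close>)
  then show "0 \<le> set_diam d U" "set_diam d U \<le> w" by auto
qed

text \<open>
  The Borel--Cantelli argument for Hausdorff measure: a set contained in the limsup of a family
  \<open>U\<close> is still covered after finitely many members are dropped, and by summability the remaining
  ones contribute arbitrarily little. The widths are positive, so summability forces the index
  set to be countable and the tail of the family can be enumerated as a cover indexed by \<open>nat\<close>.
\<close>

lemma hausdorff_null_if_limsup_cover:
  fixes U :: "'i \<Rightarrow> 'x set" and w :: "'i \<Rightarrow> real"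
  assumes "s > 0"
    and nonneg: "\<And>x y. d x y \<ge> 0"
    and wpos: "\<And>i. i \<in> I \<Longrightarrow> w i > 0"
    and sub: "\<And>i. i \<in> I \<Longrightarrow> U i \<subseteq> M"
    and bound: "\<And>i x y. i \<in> I \<Longrightarrow> x \<in> U i \<Longrightarrow> y \<in> U i \<Longrightarrow> d x y \<le> w i"
    and summ: "(\<lambda>i. w i powr s) summable_on I"
    and cover: "\<And>F x. finite F \<Longrightarrow> x \<in> A \<Longrightarrow> \<exists>i\<in>I - F. x \<in> U i"
  shows "hausdorff_measure M d s A = 0"
proof -
  have "hausdorff_premeasure M d s \<epsilon> A \<le> ennreal \<delta>" if "\<epsilon> > 0" "\<delta> > 0" for \<epsilon> \<delta>
  proof -
    \<comment> \<open>a tail below \<open>\<epsilon> powr s\<close> makes every single width at most \<open>\<epsilon>\<close>\<close>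
    define \<eta> where "\<eta> = min \<delta> (\<epsilon> powr s)"
    have "\<eta> > 0" using that by (simp add: \<eta>_def)
    obtain F where F: "finite F" "F \<subseteq> I"
      and tail: "\<And>G. finite G \<Longrightarrow> G \<subseteq> I - F \<Longrightarrow> (\<Sum>i\<in>G. w i powr s) \<le> \<eta>"
      using summable_on_small_tail[OF summ _ \<open>\<eta> > 0\<close>] by auto
    have w_le: "w i \<le> \<epsilon>" if "i \<in> I - F" for i
    proof (rule ccontr)
      assume "\<not> w i \<le> \<epsilon>"
      then have "\<epsilon> powr s < w i powr s"
        using \<open>\<epsilon> > 0\<close> \<open>s > 0\<close> by (intro powr_less_mono2) auto
      moreover have "w i powr s \<le> \<epsilon> powr s" using tail[of "{i}"] that by (simp add: \<eta>_def)
      ultimately show False by simp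
    qed
    have "countable {i \<in> I. w i powr s \<noteq> 0}" by (rule summable_countable_real[OF summ])
    moreover have "{i \<in> I. w i powr s \<noteq> 0} = I" using wpos by fastforce
    ultimately have cI: "countable I" by simp
    define e where "e = to_nat_on I"
    have e: "inj_on e I" unfolding e_def by (rule inj_on_to_nat_on[OF cI])
    \<comment> \<open>empty when \<open>j\<close> is not the number of an index outside \<open>F\<close>\<close>
    define V where "V j = \<Union> (U ` {i \<in> I - F. e i = j})" for j
    have V_e: "V (e i) = U i" if "i \<in> I - F" for i
    proof -
      have "{i' \<in> I - F. e i' = e i} = {i}" using that e by (auto dest: inj_onD)
      then show ?thesis by (simp add: V_def)
    qed
    have V_empty: "V j = {}" if "j \<notin> e ` (I - F)" for j using that by (auto simp: V_def)
    have V_in: "V j \<subseteq> M" for j using sub by (auto simp: V_def)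
    have V_diam: "d x y \<le> \<epsilon>" if "x \<in> V j" "y \<in> V j" for j x y
    proof -
      have "j \<in> e ` (I - F)" using V_empty[of j] that(1) by (cases "j \<in> e ` (I - F)") simp_all
      then obtain i where i: "i \<in> I - F" "j = e i" by (rule imageE)
      have "d x y \<le> w i" using bound[of i x y] i that V_e[OF i(1)] by simp
      then show ?thesis using w_le[OF i(1)] by linarith
    qed
    have "A \<subseteq> (\<Union>j. V j)"
    proof
      fix x assume "x \<in> A"
      then obtain i where "i \<in> I - F" "x \<in> U i" using cover[OF F(1)] by blast
      then have "x \<in> V (e i)" by (simp add: V_e)
      then show "x \<in> (\<Union>j. V j)" by blast
    qed
    then have "hausdorff_premeasure M d s \<epsilon> A \<le> (\<Sum>j. ennreal (set_diam d (V j) powr s))"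
      unfolding hausdorff_premeasure_def by (intro INF_lower) (use V_in V_diam in auto)
    also have "\<dots> \<le> ennreal \<delta>"
    proof (rule suminf_le_const)
      fix N
      define G where "G = {i \<in> I - F. e i < N}"
      have injG: "inj_on e G" using e by (auto simp: G_def inj_on_def)
      have finG: "finite G" by (rule finite_imageD[OF finite_subset[of _ "{..<N}"] injG]) (auto simp: G_def)
      have "(\<Sum>j<N. ennreal (set_diam d (V j) powr s)) = (\<Sum>j\<in>e ` G. ennreal (set_diam d (V j) powr s))"
      proof (rule sum.mono_neutral_right)
        show "\<forall>j\<in>{..<N} - e ` G. ennreal (set_diam d (V j) powr s) = 0"
        proof
          fix j assume "j \<in> {..<N} - e ` G"
          then have "V j = {}" by (intro V_empty) (auto simp: G_def)
          then show "ennreal (set_diam d (V j) powr s) = 0" by (simp add: set_diam_def)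
        qed
      qed (auto simp: G_def)
      also have "\<dots> = (\<Sum>i\<in>G. ennreal (set_diam d (U i) powr s))"
        by (subst sum.reindex[OF injG]) (auto simp: V_e G_def intro!: sum.cong)
      also have "\<dots> \<le> (\<Sum>i\<in>G. ennreal (w i powr s))"
      proof (rule sum_mono)
        fix i assume "i \<in> G"
        then have i: "i \<in> I" by (simp add: G_def)
        have "set_diam d (U i) \<le> w i" "0 \<le> set_diam d (U i)"
          using set_diam_bounds[of d "w i" "U i"] nonneg bound[OF i] wpos[OF i] by auto
        then show "ennreal (set_diam d (U i) powr s) \<le> ennreal (w i powr s)"
          using \<open>s > 0\<close> by (intro ennreal_leI powr_mono2) auto
      qed
      also have "\<dots> = ennreal (\<Sum>i\<in>G. w i powr s)" by simp
      also have "\<dots> \<le> ennreal \<delta>"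
        using tail[of G] finG by (intro ennreal_leI) (auto simp: G_def \<eta>_def)
      finally show "(\<Sum>j<N. ennreal (set_diam d (V j) powr s)) \<le> ennreal \<delta>" .
    qed simp
    finally show ?thesis .
  qed
  then have "hausdorff_premeasure M d s \<epsilon> A = 0" if "\<epsilon> > 0" for \<epsilon>
    using that ennreal_le_epsilon[of 0 "hausdorff_premeasure M d s \<epsilon> A"]
    by (metis add_0 ennreal_le_epsilon le_zero_eq)
  then show ?thesis unfolding hausdorff_measure_def by (simp add: bot_ennreal)
qed

section \<open>The Minkowski form\<close>

definition mink :: "nat \<Rightarrow> (nat \<Rightarrow> real) \<Rightarrow> (nat \<Rightarrow> real) \<Rightarrow> real" where
  "mink n x y = (\<Sum>i=1..n. x i * y i) - x 0 * y 0"

lemma mink_commute: "mink n x y = mink n y x"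
  by (simp add: mink_def mult.commute)

lemma mink_lincomb: "mink n (\<lambda>i. x i + a * z i) y = mink n x y + a * mink n z y"
  by (simp add: mink_def sum.distrib sum_distrib_left algebra_simps)

text \<open>
  For a unit timelike \<open>y\<close>, the form \<open>B x z + B x y * B z y\<close> is \<open>B\<close> applied to the components of
  \<open>x\<close> and \<open>z\<close> orthogonal to \<open>y\<close>, and \<open>B\<close> is positive on the orthogonal complement of a timelike
  vector. All the hyperbolic geometry below comes from its Cauchy--Schwarz inequality, with
  different choices of the frame \<open>y\<close>.
\<close>

lemma mink_frame_nonneg:
  assumes y: "mink n y y = -1"
  shows "0 \<le> mink n x x + (mink n x y)\<^sup>2"
proof -
  define X where "X = (\<Sum>i=1..n. x i * x i)"
  define Y where "Y = (\<Sum>i=1..n. y i * y i)"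
  define P where "P = (\<Sum>i=1..n. x i * y i)"
  have nn: "X \<ge> 0" "Y \<ge> 0" by (auto simp: X_def Y_def intro!: sum_nonneg)
  have cs: "P\<^sup>2 \<le> X * Y"
    using Cauchy_Schwarz_ineq_sum[of x y "{1..n}"] by (simp add: X_def Y_def P_def power2_eq_square)
  have y0: "(y 0)\<^sup>2 = 1 + Y" using y by (simp add: mink_def Y_def power2_eq_square)
  have eq: "mink n x x + (mink n x y)\<^sup>2 = X + P\<^sup>2 - 2 * (x 0 * y 0) * P + (x 0)\<^sup>2 * Y"
  proof -
    have "mink n x x + (mink n x y)\<^sup>2 = X - (x 0)\<^sup>2 + (P - x 0 * y 0)\<^sup>2"
      by (simp add: mink_def X_def P_def power2_eq_square)
    also have "\<dots> = X - (x 0)\<^sup>2 + P\<^sup>2 - 2 * (x 0 * y 0) * P + (x 0)\<^sup>2 * (y 0)\<^sup>2"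
      by (simp add: power2_eq_square algebra_simps)
    finally show ?thesis by (simp add: y0 algebra_simps)
  qed
  show ?thesis
  proof (cases "Y = 0")
    case True
    then have "P = 0" using cs by simp
    then show ?thesis using eq nn True by simp
  next
    case False
    then have Y: "Y > 0" using nn by simp
    \<comment> \<open>complete the square in \<open>x 0\<close>\<close>
    have "Y * (X + P\<^sup>2 - 2 * (x 0 * y 0) * P + (x 0)\<^sup>2 * Y)
        = (x 0 * Y - y 0 * P)\<^sup>2 + (X * Y - P\<^sup>2) + (1 + Y - (y 0)\<^sup>2) * P\<^sup>2"
      by (simp add: power2_eq_square algebra_simps)
    then have "Y * (X + P\<^sup>2 - 2 * (x 0 * y 0) * P + (x 0)\<^sup>2 * Y) \<ge> 0"
      using cs y0 by simp
    then show ?thesis using eq Y by (simp add: zero_le_mult_iff)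
  qed
qed

lemma mink_frame_Cauchy_Schwarz:
  assumes y: "mink n y y = -1"
  shows "(mink n x z + mink n x y * mink n z y)\<^sup>2
    \<le> (mink n x x + (mink n x y)\<^sup>2) * (mink n z z + (mink n z y)\<^sup>2)"
proof -
  define a where "a = mink n x x + (mink n x y)\<^sup>2"
  define b where "b = mink n x z + mink n x y * mink n z y"
  define c where "c = mink n z z + (mink n z y)\<^sup>2"
  have quad: "0 \<le> a + 2 * t * b + t\<^sup>2 * c" for t
  proof -
    have "0 \<le> mink n (\<lambda>i. x i + t * z i) (\<lambda>i. x i + t * z i) + (mink n (\<lambda>i. x i + t * z i) y)\<^sup>2"
      by (rule mink_frame_nonneg[OF y])
    also have "mink n (\<lambda>i. x i + t * z i) (\<lambda>i. x i + t * z i)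
        = mink n x x + 2 * t * mink n x z + t\<^sup>2 * mink n z z"
      by (subst mink_lincomb, subst (1 2) mink_commute, subst (1 2) mink_lincomb)
        (simp add: mink_commute[of n z x] power2_eq_square algebra_simps)
    finally show ?thesis
      by (simp add: mink_lincomb a_def b_def c_def power2_eq_square algebra_simps)
  qed
  have c: "c \<ge> 0" unfolding c_def by (rule mink_frame_nonneg[OF y])
  have "b\<^sup>2 \<le> a * c"
  proof (cases "c = 0")
    case True
    have "b = 0"
    proof (rule ccontr)
      assume "b \<noteq> 0"
      then show False using quad[of "-(a + 1) / (2 * b)"] True by (simp add: field_simps)
    qed
    then show ?thesis using True by simp
  next
    case False
    have "0 \<le> c * (a + 2 * (- b / c) * b + (- b / c)\<^sup>2 * c)"
      using quad c by (intro mult_nonneg_nonneg)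
    also have "\<dots> = a * c - b\<^sup>2" using False by (simp add: field_simps power2_eq_square)
    finally show ?thesis by simp
  qed
  then show ?thesis by (simp add: a_def b_def c_def)
qed

definition hyperboloid :: "nat \<Rightarrow> (nat \<Rightarrow> real) \<Rightarrow> bool" where
  "hyperboloid n x \<longleftrightarrow> mink n x x = -1 \<and> x 0 > 0"

text \<open>
  Cauchy--Schwarz for the spatial parts, which are no longer than the time parts and strictly
  shorter for \<open>x\<close>. The sign makes the argument of \<open>arcosh\<close> in the hyperbolic distance positive, and
  likewise the exponentiated Busemann functions below.
\<close>

lemma mink_neg:
  assumes x: "hyperboloid n x" and z: "mink n z z \<le> 0" "z 0 > 0"
  shows "mink n x z < 0"
proof -
  define X where "X = (\<Sum>i=1..n. x i * x i)"
  define Z where "Z = (\<Sum>i=1..n. z i * z i)"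
  define P where "P = (\<Sum>i=1..n. x i * z i)"
  have x0: "X = (x 0)\<^sup>2 - 1" "x 0 > 0" using x by (auto simp: hyperboloid_def mink_def X_def power2_eq_square)
  have z0: "Z \<le> (z 0)\<^sup>2" using z by (simp add: mink_def Z_def power2_eq_square)
  have "X \<ge> 0" by (auto simp: X_def intro!: sum_nonneg)
  have "P\<^sup>2 \<le> X * Z"
    using Cauchy_Schwarz_ineq_sum[of x z "{1..n}"] by (simp add: X_def Z_def P_def power2_eq_square)
  also have "\<dots> \<le> X * (z 0)\<^sup>2" using \<open>X \<ge> 0\<close> z0 by (rule mult_left_mono[rotated])
  also have "\<dots> < (x 0 * z 0)\<^sup>2" using x0(1) z(2) by (simp add: power_mult_distrib algebra_simps)
  finally have "P < x 0 * z 0" by (rule power2_less_imp_less) (use x0 z in simp)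
  then show ?thesis by (simp add: mink_def P_def)
qed

lemma mink_hyperboloid_le:
  assumes "hyperboloid n x" "hyperboloid n y"
  shows "mink n x y \<le> -1"
proof -
  have "1 \<le> (mink n x y)\<^sup>2"
    using mink_frame_nonneg[of n y x] assms by (simp add: hyperboloid_def)
  then have "1 \<le> \<bar>mink n x y\<bar>" using abs_le_square_iff[of 1 "mink n x y"] by simp
  moreover have "mink n x y < 0" by (rule mink_neg) (use assms in \<open>auto simp: hyperboloid_def\<close>)
  ultimately show ?thesis by linarith
qed

section \<open>Hyperbolic distance and Busemann functions\<close>

lemma lorentz_form_mink:
  assumes "dim_vec x = n + 1"
  shows "lorentz_form x y = mink n (vec_index x) (vec_index y)"
  using assms by (simp add: lorentz_form_def mink_def atLeastLessThanSuc_atLeastAtMost)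

lemma hyp_space_hyperboloid:
  assumes "x \<in> hyp_space n"
  shows "hyperboloid n (vec_index x)"
proof -
  have "dim_vec x = n + 1" "lorentz_form x x = -1" "x $v 0 > 0"
    using assms by (auto simp: hyp_space_def)
  then show ?thesis using lorentz_form_mink[of x n x] by (simp add: hyperboloid_def)
qed

lemma hyp_dist_mink:
  assumes "x \<in> hyp_space n"
  shows "hyp_dist x y = arcosh (- mink n (vec_index x) (vec_index y))"
proof -
  have "dim_vec x = n + 1" using assms by (auto simp: hyp_space_def)
  then show ?thesis by (simp add: hyp_dist_def lorentz_form_mink[of x n y])
qed

lemma cosh_hyp_dist:
  assumes "x \<in> hyp_space n" "y \<in> hyp_space n"
  shows "cosh (hyp_dist x y) = - mink n (vec_index x) (vec_index y)"
  using mink_hyperboloid_le[OF assms[THEN hyp_space_hyperboloid]]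
  by (simp add: hyp_dist_mink[OF assms(1)])

lemma hyp_dist_nonneg:
  assumes "x \<in> hyp_space n" "y \<in> hyp_space n"
  shows "0 \<le> hyp_dist x y"
  using mink_hyperboloid_le[OF assms[THEN hyp_space_hyperboloid]]
  by (simp add: hyp_dist_mink[OF assms(1)])

lemma hyp_dist_commute:
  assumes "x \<in> hyp_space n" "y \<in> hyp_space n"
  shows "hyp_dist x y = hyp_dist y x"
  by (simp add: hyp_dist_mink[OF assms(1)] hyp_dist_mink[OF assms(2)] mink_commute[of n "vec_index x"])

text \<open>
  In the frame of the middle point \<open>y\<close>, the orthogonal parts of \<open>x\<close> and \<open>z\<close> have lengths \<open>sinh a\<close>
  and \<open>sinh b\<close> for the two distances \<open>a\<close>, \<open>b\<close>, so Cauchy--Schwarz is the addition formula for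
  \<open>cosh (a + b)\<close>.
\<close>

lemma hyp_dist_triangle:
  assumes x: "x \<in> hyp_space n" and y: "y \<in> hyp_space n" and z: "z \<in> hyp_space n"
  shows "hyp_dist x z \<le> hyp_dist x y + hyp_dist y z"
proof -
  let ?m = "\<lambda>a b. mink n (vec_index a) (vec_index b)"
  define a where "a = hyp_dist x y"
  define b where "b = hyp_dist y z"
  have ab: "a \<ge> 0" "b \<ge> 0" by (simp_all add: a_def b_def hyp_dist_nonneg[OF x y] hyp_dist_nonneg[OF y z])
  have m: "?m x y = - cosh a" "?m z y = - cosh b" "?m x z = - cosh (hyp_dist x z)"
    using cosh_hyp_dist[OF x y] cosh_hyp_dist[OF y z] cosh_hyp_dist[OF x z]
    by (simp_all add: a_def b_def mink_commute[of n "vec_index z"])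
  have "(?m x z + ?m x y * ?m z y)\<^sup>2 \<le> (?m x x + (?m x y)\<^sup>2) * (?m z z + (?m z y)\<^sup>2)"
    by (rule mink_frame_Cauchy_Schwarz) (use hyp_space_hyperboloid[OF y] in \<open>simp add: hyperboloid_def\<close>)
  also have "\<dots> = (sinh a * sinh b)\<^sup>2"
    using hyp_space_hyperboloid[OF x] hyp_space_hyperboloid[OF z]
    by (simp add: hyperboloid_def m power_mult_distrib sinh_square_eq)
  finally have "\<bar>- cosh (hyp_dist x z) + cosh a * cosh b\<bar> \<le> \<bar>sinh a * sinh b\<bar>"
    unfolding abs_le_square_iff by (simp add: m)
  moreover have "\<bar>sinh a * sinh b\<bar> = sinh a * sinh b" using ab by (simp add: abs_mult)
  ultimately have "cosh (hyp_dist x z) \<le> cosh (a + b)" by (simp add: cosh_add)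
  then show ?thesis
    using ab hyp_dist_nonneg[OF x z] cosh_real_nonneg_le_iff[of "hyp_dist x z" "a + b"] by (simp add: a_def b_def)
qed

text \<open>
  The isotropic vector \<open>(1, \<xi>)\<close> representing the boundary point \<open>\<xi>\<close>. The logarithm of
  \<open>- mink n x (null_lift \<xi>)\<close> is the Busemann function at \<open>\<xi>\<close>, up to an additive constant.
\<close>

definition null_lift :: "real Matrix.vec \<Rightarrow> nat \<Rightarrow> real" where
  "null_lift \<xi> i = (if i = 0 then 1 else \<xi> $v (i - 1))"

lemma mink_null_lift:
  assumes "dim_vec \<eta> = n"
  shows "mink n (null_lift \<xi>) (null_lift \<eta>) = scalar_prod \<xi> \<eta> - 1"
proof -
  have "(\<Sum>i=1..n. null_lift \<xi> i * null_lift \<eta> i) = (\<Sum>i<n. \<xi> $v i * \<eta> $v i)"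
    by (rule sum.reindex_bij_witness[of _ Suc "\<lambda>i. i - 1"]) (auto simp: null_lift_def)
  then show ?thesis
    using assms by (simp add: mink_def scalar_prod_def null_lift_def lessThan_atLeast0)
qed

lemma bdry_sphereD:
  assumes "\<xi> \<in> bdry_sphere n"
  shows "dim_vec \<xi> = n" "scalar_prod \<xi> \<xi> = 1"
  using assms by (auto simp: bdry_sphere_def)

lemma mink_null_lift_self:
  assumes "\<xi> \<in> bdry_sphere n"
  shows "mink n (null_lift \<xi>) (null_lift \<xi>) = 0"
  by (simp add: mink_null_lift[OF bdry_sphereD(1)[OF assms]] bdry_sphereD(2)[OF assms])

lemma mink_null_lift_neg:
  assumes "x \<in> hyp_space n" "\<xi> \<in> bdry_sphere n"
  shows "mink n (vec_index x) (null_lift \<xi>) < 0"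
  by (rule mink_neg[OF hyp_space_hyperboloid[OF assms(1)]])
    (simp_all add: mink_null_lift_self[OF assms(2)] null_lift_def)

text \<open>
  The basepoint is arbitrary, whereas angles on the boundary are measured from the origin of the
  ball model; this bound accounts for the difference by a constant factor.
\<close>

lemma minus_mink_null_lift_le:
  assumes x: "x \<in> hyp_space n" and \<xi>: "\<xi> \<in> bdry_sphere n"
  shows "- mink n (vec_index x) (null_lift \<xi>) \<le> 2 * x $v 0"
proof -
  define X where "X = (\<Sum>i=1..n. x $v i * x $v i)"
  define Z where "Z = (\<Sum>i=1..n. null_lift \<xi> i * null_lift \<xi> i)"
  define P where "P = (\<Sum>i=1..n. x $v i * null_lift \<xi> i)"
  have x0: "X = (x $v 0)\<^sup>2 - 1" "x $v 0 > 0"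
    using hyp_space_hyperboloid[OF x] by (auto simp: hyperboloid_def mink_def X_def power2_eq_square)
  have Z: "Z = 1" using mink_null_lift_self[OF \<xi>] by (simp add: mink_def Z_def null_lift_def)
  have "P\<^sup>2 \<le> X * Z"
    using Cauchy_Schwarz_ineq_sum[of "vec_index x" "null_lift \<xi>" "{1..n}"]
    by (simp add: X_def Z_def P_def power2_eq_square)
  then have "P\<^sup>2 \<le> (x $v 0)\<^sup>2" using x0 Z by simp
  then have "\<bar>P\<bar> \<le> x $v 0" using x0(2) abs_le_square_iff[of P "x $v 0"] by simp
  then show ?thesis by (simp add: mink_def P_def null_lift_def)
qed

text \<open>
  Busemann functions are 1-Lipschitz. In the frame of \<open>x\<close>, the spatial part of the null vector has
  the same length \<open>b\<close> as its time part and that of \<open>g\<close> has length \<open>sinh d\<close>, which bounds the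
  left-hand side by \<open>(cosh d + sinh d) * b\<close>.
\<close>

lemma busemann_Lipschitz:
  assumes x: "x \<in> hyp_space n" and g: "g \<in> hyp_space n" and \<xi>: "\<xi> \<in> bdry_sphere n"
  shows "- mink n (vec_index g) (null_lift \<xi>)
    \<le> exp (hyp_dist x g) * (- mink n (vec_index x) (null_lift \<xi>))"
proof -
  define d where "d = hyp_dist x g"
  define b where "b = - mink n (null_lift \<xi>) (vec_index x)"
  have d: "d \<ge> 0" unfolding d_def by (rule hyp_dist_nonneg[OF x g])
  have b: "b > 0" using mink_null_lift_neg[OF x \<xi>] by (simp add: b_def mink_commute)
  have c: "mink n (vec_index g) (vec_index x) = - cosh d"
    by (simp add: d_def cosh_hyp_dist[OF x g] mink_commute[of n "vec_index g"])
  have "(mink n (vec_index g) (null_lift \<xi>)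
        + mink n (vec_index g) (vec_index x) * mink n (null_lift \<xi>) (vec_index x))\<^sup>2
      \<le> (mink n (vec_index g) (vec_index g) + (mink n (vec_index g) (vec_index x))\<^sup>2)
        * (mink n (null_lift \<xi>) (null_lift \<xi>) + (mink n (null_lift \<xi>) (vec_index x))\<^sup>2)"
    by (rule mink_frame_Cauchy_Schwarz) (use hyp_space_hyperboloid[OF x] in \<open>simp add: hyperboloid_def\<close>)
  also have "\<dots> = (sinh d * b)\<^sup>2"
    using hyp_space_hyperboloid[OF g]
    by (simp add: hyperboloid_def mink_null_lift_self[OF \<xi>] c b_def power_mult_distrib sinh_square_eq)
  finally have "\<bar>mink n (vec_index g) (null_lift \<xi>) + cosh d * b\<bar> \<le> \<bar>sinh d * b\<bar>"
    unfolding abs_le_square_iff by (simp add: c b_def)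
  moreover have "\<bar>sinh d * b\<bar> = sinh d * b" using d b by (simp add: abs_mult)
  ultimately have "- mink n (vec_index g) (null_lift \<xi>) \<le> (cosh d + sinh d) * b"
    by (simp add: algebra_simps)
  then show ?thesis by (simp add: cosh_plus_sinh b_def d_def mink_commute[of n "null_lift \<xi>"])
qed

text \<open>
  Rescaled to have time part 1 in the frame of \<open>g\<close>, the two null vectors become \<open>(1, \<xi>')\<close> and
  \<open>(1, \<eta>')\<close> with unit vectors \<open>\<xi>'\<close>, \<open>\<eta>'\<close>, and \<open>1 - \<xi>' \<bullet> \<eta>'\<close> is at most 2. So two boundary points
  are close as soon as both Busemann functions are very negative at one common point.
\<close>

lemma one_minus_cos_visual:
  assumes g: "g \<in> hyp_space n" and \<xi>: "\<xi> \<in> bdry_sphere n" and \<eta>: "\<eta> \<in> bdry_sphere n"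
  shows "1 - scalar_prod \<xi> \<eta>
    \<le> 2 * (- mink n (vec_index g) (null_lift \<xi>)) * (- mink n (vec_index g) (null_lift \<eta>))"
proof -
  let ?a = "mink n (null_lift \<xi>) (vec_index g)" and ?b = "mink n (null_lift \<eta>) (vec_index g)"
  have "(mink n (null_lift \<xi>) (null_lift \<eta>) + ?a * ?b)\<^sup>2
      \<le> (mink n (null_lift \<xi>) (null_lift \<xi>) + ?a\<^sup>2) * (mink n (null_lift \<eta>) (null_lift \<eta>) + ?b\<^sup>2)"
    by (rule mink_frame_Cauchy_Schwarz) (use hyp_space_hyperboloid[OF g] in \<open>simp add: hyperboloid_def\<close>)
  also have "\<dots> = (?a * ?b)\<^sup>2"
    by (simp add: mink_null_lift_self[OF \<xi>] mink_null_lift_self[OF \<eta>] power_mult_distrib)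
  finally have "\<bar>mink n (null_lift \<xi>) (null_lift \<eta>) + ?a * ?b\<bar> \<le> \<bar>?a * ?b\<bar>"
    by (simp add: abs_le_square_iff)
  moreover have "?a * ?b > 0"
    using mink_null_lift_neg[OF g \<xi>] mink_null_lift_neg[OF g \<eta>]
    by (simp add: mink_commute[of n "vec_index g"] mult_neg_neg)
  moreover have "mink n (null_lift \<xi>) (null_lift \<eta>) = scalar_prod \<xi> \<eta> - 1"
    by (rule mink_null_lift[OF bdry_sphereD(1)[OF \<eta>]])
  ultimately show ?thesis by (simp add: mink_commute[of n "vec_index g"])
qed

text \<open>
  The Busemann function decreases with unit speed along the ray. Rays are given by their metric
  properties only, so this is obtained as a limit: along the ray \<open>- mink n (r t) (r s)\<close> equals
  \<open>cosh (s - t)\<close>, the rescaled points \<open>r s / r s $v 0\<close> tend to the null vector of the endpoint, and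
  \<open>cosh (s - t) / cosh s\<close> tends to \<open>exp (- t)\<close>.
\<close>

lemma geodesic_ray_mink_decay:
  assumes r: "geodesic_ray n p \<xi> r" and t: "t \<ge> 0"
  shows "mink n (vec_index (r t)) (null_lift \<xi>) = exp (- t) * mink n (vec_index p) (null_lift \<xi>)"
proof -
  have rH: "r s \<in> hyp_space n" if "s \<ge> 0" for s using r that by (simp add: geodesic_ray_def)
  have r0: "r 0 = p" using r by (simp add: geodesic_ray_def)
  have dist: "hyp_dist (r s) (r s') = \<bar>s - s'\<bar>" if "s \<ge> 0" "s' \<ge> 0" for s s'
    using r that by (simp add: geodesic_ray_def)
  have proj: "((\<lambda>s. r s $v i / r s $v 0) \<longlongrightarrow> null_lift \<xi> i) at_top" if "i \<in> {1..n}" for i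
  proof -
    have "\<forall>i<n. ((\<lambda>s. r s $v (i + 1) / r s $v 0) \<longlongrightarrow> \<xi> $v i) at_top"
      using r unfolding geodesic_ray_def tends_to_bdry_def by blast
    moreover have "i - 1 < n" using that by auto
    ultimately have "((\<lambda>s. r s $v (i - 1 + 1) / r s $v 0) \<longlongrightarrow> \<xi> $v (i - 1)) at_top"
      by blast
    then show ?thesis using that by (simp add: null_lift_def)
  qed
  have lim: "((\<lambda>s. mink n x (vec_index (r s)) / r s $v 0) \<longlongrightarrow> mink n x (null_lift \<xi>)) at_top" for x
  proof -
    have "((\<lambda>s. (\<Sum>i=1..n. x i * (r s $v i / r s $v 0)) - x 0) \<longlongrightarrow>
        (\<Sum>i=1..n. x i * null_lift \<xi> i) - x 0) at_top"
      by (intro tendsto_intros proj)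
    moreover have "\<forall>\<^sub>F s in at_top. (\<Sum>i=1..n. x i * (r s $v i / r s $v 0)) - x 0
        = mink n x (vec_index (r s)) / r s $v 0"
      using eventually_ge_at_top[of 0]
    proof eventually_elim
      case (elim s)
      then have "r s $v 0 > 0" using rH[of s] by (simp add: hyp_space_def)
      then show ?case by (simp add: mink_def sum_divide_distrib diff_divide_distrib)
    qed
    ultimately have "((\<lambda>s. mink n x (vec_index (r s)) / r s $v 0) \<longlongrightarrow>
        (\<Sum>i=1..n. x i * null_lift \<xi> i) - x 0) at_top"
      by (rule Lim_transform_eventually)
    then show ?thesis by (simp add: mink_def null_lift_def)
  qed
  have "((\<lambda>s. (cosh t - sinh t * tanh s) * (mink n (vec_index p) (vec_index (r s)) / r s $v 0)) \<longlongrightarrow>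
      (cosh t - sinh t * 1) * mink n (vec_index p) (null_lift \<xi>)) at_top"
    by (intro tendsto_intros lim tanh_real_at_top)
  moreover have "\<forall>\<^sub>F s in at_top. (cosh t - sinh t * tanh s) * (mink n (vec_index p) (vec_index (r s)) / r s $v 0)
      = mink n (vec_index (r t)) (vec_index (r s)) / r s $v 0"
    using eventually_ge_at_top[of t]
  proof eventually_elim
    case (elim s)
    then have s: "s \<ge> 0" using t by simp
    have "mink n (vec_index p) (vec_index (r s)) = - cosh s"
      using cosh_hyp_dist[OF rH[of 0] rH[OF s]] dist[of 0 s] s r0 by simp
    moreover have "mink n (vec_index (r t)) (vec_index (r s)) = - cosh (s - t)"
      using cosh_hyp_dist[OF rH[OF t] rH[OF s]] dist[OF t s] elim by simp
    moreover have "cosh (s - t) = (cosh t - sinh t * tanh s) * cosh s"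
      by (simp add: cosh_diff tanh_def algebra_simps)
    ultimately show ?case by simp
  qed
  ultimately have "((\<lambda>s. mink n (vec_index (r t)) (vec_index (r s)) / r s $v 0) \<longlongrightarrow>
      (cosh t - sinh t * 1) * mink n (vec_index p) (null_lift \<xi>)) at_top"
    by (rule Lim_transform_eventually)
  from tendsto_unique[OF _ lim this] show ?thesis
    by (simp add: cosh_minus_sinh)
qed

text \<open>
  By concavity, \<open>sin\<close> lies above its chord on \<open>{0..pi/2}\<close>. This turns the quadratic quantity
  \<open>1 - cos \<theta>\<close>, which the Minkowski form sees, into a bound on the angle itself.
\<close>

lemma one_minus_cos_ge:
  assumes "0 \<le> \<theta>" "\<theta> \<le> pi"
  shows "2 * (\<theta> / pi)\<^sup>2 \<le> 1 - cos \<theta>"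
proof -
  have "concave_on {0..pi/2} sin"
    by (rule f''_le0_imp_concave[where f' = cos and f'' = "\<lambda>x. - sin x"])
      (auto intro!: derivative_eq_intros sin_ge_zero)
  from concave_onD_Icc[OF this, of "\<theta> / pi"] have "\<theta> / pi \<le> sin (\<theta> / 2)"
    using assms by simp
  then have "(\<theta> / pi)\<^sup>2 \<le> (sin (\<theta> / 2))\<^sup>2" using assms by (intro power_mono) auto
  then show ?thesis using cos_double_sin[of "\<theta> / 2"] by simp
qed

lemma bdry_sphere_scalar_prod_bounds:
  assumes \<xi>: "\<xi> \<in> bdry_sphere n" and \<eta>: "\<eta> \<in> bdry_sphere n"
  shows "\<bar>scalar_prod \<xi> \<eta>\<bar> \<le> 1"
proof -
  have "(scalar_prod \<xi> \<eta>)\<^sup>2 \<le> scalar_prod \<xi> \<xi> * scalar_prod \<eta> \<eta>"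
    using Cauchy_Schwarz_ineq_sum[of "vec_index \<xi>" "vec_index \<eta>" "{0..<n}"] 
    by (simp add: scalar_prod_def bdry_sphereD(1)[OF \<xi>] bdry_sphereD(1)[OF \<eta>] power2_eq_square)
  then have "(scalar_prod \<xi> \<eta>)\<^sup>2 \<le> 1\<^sup>2" by (simp add: bdry_sphereD(2)[OF \<xi>] bdry_sphereD(2)[OF \<eta>])
  then show ?thesis by (simp add: abs_square_le_1)
qed

text \<open>
  The shadow of a ball of radius \<open>R\<close> at distance about \<open>\<tau>\<close> from \<open>p\<close> has angular size of order
  \<open>exp (R - \<tau>)\<close>: unit-speed decay along each ray and the Lipschitz bound bound both
  exponentiated Busemann functions at \<open>g\<close> by a multiple of this, and their product controls \<open>1 - cos \<theta>\<close>, which is of order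
  \<open>\<theta>\<^sup>2\<close>.
\<close>

lemma sphere_dist_le_of_rays_near:
  assumes r: "geodesic_ray n p \<xi> r" and r': "geodesic_ray n p \<eta> r'"
    and \<xi>: "\<xi> \<in> bdry_sphere n" and \<eta>: "\<eta> \<in> bdry_sphere n" and g: "g \<in> hyp_space n"
    and t: "t \<ge> 0" "\<tau> \<le> t" and t': "t' \<ge> 0" "\<tau> \<le> t'"
    and near: "hyp_dist (r t) g \<le> R" "hyp_dist (r' t') g \<le> R"
  shows "sphere_dist \<xi> \<eta> \<le> 2 * pi * p $v 0 * exp (R - \<tau>)"
proof -
  have p: "p \<in> hyp_space n" using r by (auto simp: geodesic_ray_def)
  have p0: "p $v 0 > 0" using p by (simp add: hyp_space_def)
  define \<theta> where "\<theta> = sphere_dist \<xi> \<eta>"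
  have bounds: "\<bar>scalar_prod \<xi> \<eta>\<bar> \<le> 1" by (rule bdry_sphere_scalar_prod_bounds[OF \<xi> \<eta>])
  have \<theta>: "0 \<le> \<theta>" "\<theta> \<le> pi" "cos \<theta> = scalar_prod \<xi> \<eta>"
    using bounds by (auto simp: \<theta>_def sphere_dist_def arccos_lbound arccos_ubound cos_arccos_abs)
  have near_bound: "- mink n (vec_index g) (null_lift \<zeta>) \<le> 2 * p $v 0 * exp (R - \<tau>)"
    if "geodesic_ray n p \<zeta> q" "\<zeta> \<in> bdry_sphere n" "a \<ge> 0" "\<tau> \<le> a" "hyp_dist (q a) g \<le> R" for \<zeta> q a
  proof -
    have qa: "q a \<in> hyp_space n" using that by (simp add: geodesic_ray_def)
    have "- mink n (vec_index g) (null_lift \<zeta>)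
        \<le> exp (hyp_dist (q a) g) * (- mink n (vec_index (q a)) (null_lift \<zeta>))"
      by (rule busemann_Lipschitz[OF qa g that(2)])
    also have "\<dots> = exp (hyp_dist (q a) g - a) * (- mink n (vec_index p) (null_lift \<zeta>))"
      by (simp add: geodesic_ray_mink_decay[OF that(1,3)] exp_diff exp_minus field_simps)
    also have "\<dots> \<le> exp (R - \<tau>) * (2 * p $v 0)"
      using that p0 minus_mink_null_lift_le[OF p that(2)] mink_null_lift_neg[OF p that(2)]
      by (intro mult_mono) auto
    finally show ?thesis by (simp add: mult_ac)
  qed
  have "2 * (\<theta> / pi)\<^sup>2 \<le> 1 - scalar_prod \<xi> \<eta>" using one_minus_cos_ge[OF \<theta>(1,2)] \<theta>(3) by simp
  also have "\<dots> \<le> 2 * (- mink n (vec_index g) (null_lift \<xi>)) * (- mink n (vec_index g) (null_lift \<eta>))"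
    by (rule one_minus_cos_visual[OF g \<xi> \<eta>])
  also have "\<dots> \<le> 2 * (2 * p $v 0 * exp (R - \<tau>)) * (2 * p $v 0 * exp (R - \<tau>))"
    using near_bound[OF r \<xi> t near(1)] near_bound[OF r' \<eta> t' near(2)] p0
      mink_null_lift_neg[OF g \<xi>] mink_null_lift_neg[OF g \<eta>]
    by (intro mult_mono) auto
  finally have "(\<theta> / pi)\<^sup>2 \<le> (2 * p $v 0 * exp (R - \<tau>))\<^sup>2" by (simp add: power2_eq_square)
  then have "\<theta> / pi \<le> 2 * p $v 0 * exp (R - \<tau>)" by (rule power2_le_imp_le) (use p0 in simp)
  then show ?thesis by (simp add: \<theta>_def field_simps)
qed

section \<open>The identity component preserves the future sheet\<close>

text \<open>
  An element of \<open>SO_set n\<close> might exchange the two sheets of the hyperboloid. The time coordinate of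
  the image of \<open>x\<close> is continuous in the matrix and never zero, because the form would otherwise be
  nonnegative there; so its sign is the same on all of a connected set as at the identity.
\<close>

lemma SO_circ_preserves_hyp_space:
  assumes A: "A \<in> carrier (SO_circ n)" and x: "x \<in> hyp_space n"
  shows "A *\<^sub>v x \<in> hyp_space n"
proof -
  define X where "X = subtopology (mat_topology (n + 1)) (SO_set n)"
  define f where "f B = (B *\<^sub>v x) $v 0" for B :: "real mat"
  have dx: "dim_vec x = n + 1" and xc: "x \<in> carrier_vec (n + 1)" and x0: "x $v 0 > 0"
    and xx: "lorentz_form x x = -1"
    using x by (auto simp: hyp_space_def)
  obtain T where T: "connectedin X T" "1\<^sub>m (n + 1) \<in> T" "A \<in> T"
    using A by (auto simp: SO_circ_def X_def connected_component_of_def)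
  have TS: "T \<subseteq> SO_set n"
    using connectedin_subset_topspace[OF T(1)] by (auto simp: X_def)
  have dim: "dim_row B = n + 1" "dim_col B = n + 1" if "B \<in> SO_set n" for B
    using that by (auto simp: SO_set_def)
  have form: "mink n (vec_index (B *\<^sub>v x)) (vec_index (B *\<^sub>v x)) = -1" if B: "B \<in> SO_set n" for B
  proof -
    have "lorentz_form (B *\<^sub>v x) (B *\<^sub>v x) = -1" using B xc xx by (simp add: SO_set_def)
    then show ?thesis
      using lorentz_form_mink[of "B *\<^sub>v x" n "B *\<^sub>v x"] dim[OF B] by simp
  qed
  have nonzero: "f B \<noteq> 0" if B: "B \<in> SO_set n" for B
  proof
    assume "f B = 0"
    then have "mink n (vec_index (B *\<^sub>v x)) (vec_index (B *\<^sub>v x)) \<ge> 0"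
      by (simp add: mink_def f_def sum_nonneg)
    then show False using form[OF B] by simp
  qed
  have entry: "continuous_map X euclideanreal (\<lambda>B. B $$ (0, j))" if j: "j < n + 1" for j
  proof -
    let ?e = "\<lambda>B (i, j). if i < n + 1 \<and> j < n + 1 then B $$ (i, j) else (0::real)"
    have "continuous_map euclidean euclideanreal (\<lambda>h :: nat \<times> nat \<Rightarrow> real. h (0, j))"
      by simp
    then have "continuous_map (mat_topology (n + 1)) euclideanreal ((\<lambda>h. h (0, j)) \<circ> ?e)"
      unfolding mat_topology_def by (rule continuous_map_pullback)
    moreover have "(\<lambda>h. h (0, j)) \<circ> ?e = (\<lambda>B. B $$ (0, j))"
      using j by (auto simp: fun_eq_iff)
    ultimately show ?thesis unfolding X_def by (simp add: continuous_map_from_subtopology)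
  qed
  have "continuous_map X euclideanreal (\<lambda>B. \<Sum>j\<in>{0..<n + 1}. B $$ (0, j) * x $v j)"
    by (intro continuous_map_sum continuous_map_real_mult entry) auto
  then have "continuous_map X euclideanreal f"
  proof (rule continuous_map_eq)
    fix B assume "B \<in> topspace X"
    then have "B \<in> SO_set n" by (simp add: X_def)
    then show "(\<Sum>j\<in>{0..<n + 1}. B $$ (0, j) * x $v j) = f B"
      using dim[of B] dx by (simp add: f_def scalar_prod_def)
  qed
  then have "connected (f ` T)"
    using connectedin_continuous_map_image T(1) by (metis connectedin_iff_connected)
  moreover have "f (1\<^sub>m (n + 1)) > 0" using x0 xc by (simp add: f_def)
  ultimately have "f A > 0"
    using connectedD_interval[of "f ` T" "f A" "f (1\<^sub>m (n + 1))" 0] T TS nonzero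
    by (smt (verit) imageE imageI subsetD)
  moreover have "A \<in> SO_set n" using T TS by blast
  moreover have "A *\<^sub>v x \<in> carrier_vec (n + 1)"
    using dim[OF \<open>A \<in> SO_set n\<close>] by (intro carrier_vecI) simp
  moreover have "lorentz_form (A *\<^sub>v x) (A *\<^sub>v x) = -1"
    using \<open>A \<in> SO_set n\<close> xc xx by (simp add: SO_set_def)
  ultimately show ?thesis by (simp add: hyp_space_def f_def)
qed

section \<open>Cartan projections and the limit cone\<close>

lemma norm_cartan_proj: "norm (cartan_proj p g) = prod_dist (prod_act g p) p"
  by (simp add: norm_vec_def L2_set_def cartan_proj_def prod_dist_def prod_act_def)

lemma hyp_dist_le_prod_dist:
  assumes "0 \<le> hyp_dist (x i) (y i)"
  shows "hyp_dist (x i) (y i) \<le> prod_dist x y"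
proof -
  have "hyp_dist (x i) (y i) = sqrt ((hyp_dist (x i) (y i))\<^sup>2)" using assms by simp
  also have "\<dots> \<le> prod_dist x y"
    unfolding prod_dist_def by (intro real_sqrt_le_mono member_le_sum) auto
  finally show ?thesis .
qed

text \<open>
  A flat ray in direction \<open>u\<close> sits at time \<open>t\<close> at vector-valued distance exactly \<open>t *\<^sub>R u\<close> from the
  basepoint, so the triangle inequality in each factor gives the estimate.
\<close>

lemma cartan_proj_near_flat_ray:
  assumes rays: "\<And>i. geodesic_ray (n i) (p i) (\<xi> i) (r i)"
    and orbit: "\<And>i. g i *\<^sub>v p i \<in> hyp_space (n i)"
    and "\<And>i. u $ i \<ge> 0" "t \<ge> 0"
  shows "norm (cartan_proj p g - t *\<^sub>R u) \<le> prod_dist (\<lambda>i. r i (t * u $ i)) (prod_act g p)"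
proof -
  have "\<bar>hyp_dist (g i *\<^sub>v p i) (p i) - t * u $ i\<bar> \<le> hyp_dist (r i (t * u $ i)) (g i *\<^sub>v p i)" for i
  proof -
    define x where "x = r i (t * u $ i)"
    define y where "y = g i *\<^sub>v p i"
    have tu: "t * u $ i \<ge> 0" using assms by simp
    have x: "x \<in> hyp_space (n i)" and p: "p i \<in> hyp_space (n i)"
      using rays[of i] tu unfolding geodesic_ray_def x_def by (blast, metis order_refl)
    have y: "y \<in> hyp_space (n i)" unfolding y_def by (rule orbit)
    have "\<forall>s\<ge>0. \<forall>t\<ge>0. hyp_dist (r i s) (r i t) = \<bar>s - t\<bar>" and r0: "r i 0 = p i"
      using rays[of i] unfolding geodesic_ray_def by blast+
    then have "hyp_dist (r i (t * u $ i)) (r i 0) = \<bar>t * u $ i - 0\<bar>" using tu by blast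
    then have "hyp_dist x (p i) = t * u $ i" using tu r0 by (simp add: x_def)
    moreover have "hyp_dist x (p i) \<le> hyp_dist x y + hyp_dist y (p i)"
      by (rule hyp_dist_triangle[OF x y p])
    moreover have "hyp_dist y (p i) \<le> hyp_dist y x + hyp_dist x (p i)"
      by (rule hyp_dist_triangle[OF y x p])
    moreover have "hyp_dist y x = hyp_dist x y" by (rule hyp_dist_commute[OF y x])
    ultimately have "\<bar>hyp_dist y (p i) - t * u $ i\<bar> \<le> hyp_dist x y" by linarith
    then show ?thesis by (simp add: x_def y_def)
  qed
  then show ?thesis
    by (auto simp: norm_vec_def L2_set_def cartan_proj_def prod_dist_def prod_act_def
        intro!: sum_mono abs_le_square_iff[THEN iffD1] order_trans[OF _ abs_ge_self])
qed

lemma limit_cone_nonneg: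
  assumes v: "v \<in> limit_cone p \<Gamma>"
    and \<Gamma>: "\<And>g. g \<in> \<Gamma> \<Longrightarrow> 0 \<le> hyp_dist (g i *\<^sub>v p i) (p i)"
  shows "0 \<le> v $ i"
proof -
  obtain t g where tg: "\<And>j. t j > 0" "\<And>j. g j \<in> \<Gamma>"
    and lim: "(\<lambda>j. t j *\<^sub>R cartan_proj p (g j)) \<longlonglongrightarrow> v"
    using v by (auto simp: limit_cone_def)
  have "(\<lambda>j. (t j *\<^sub>R cartan_proj p (g j)) $ i) \<longlonglongrightarrow> v $ i" by (rule tendsto_vec_nth[OF lim])
  moreover have "0 \<le> (t j *\<^sub>R cartan_proj p (g j)) $ i" for j
    using tg[of j] \<Gamma>[of "g j"] by (simp add: cartan_proj_def)
  ultimately show ?thesis by (intro LIMSEQ_le_const) auto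
qed

text \<open>
  Limit cones lie in the closed orthant, so their interior directions have positive coordinates;
  this is what makes \<open>m\<^sub>u\<close> positive.
\<close>

lemma interior_orthant_pos:
  fixes u :: "real ^ 'k"
  assumes u: "u \<in> interior S" and S: "\<And>v. v \<in> S \<Longrightarrow> 0 \<le> v $ i"
  shows "0 < u $ i"
proof -
  obtain e where e: "e > 0" "ball u e \<subseteq> S" using u by (auto simp: mem_interior)
  have "u - (e / 2) *\<^sub>R axis i 1 \<in> ball u e" using e by (simp add: dist_norm norm_axis_1)
  then have "0 \<le> (u - (e / 2) *\<^sub>R axis i 1) $ i" using e S by blast
  then show ?thesis using e by (simp add: axis_def)
qed

text \<open>
  The scalars in the definition of the limit cone tend to 0, so a nonzero limit requires Cartan
  projections of unbounded norm, and these end up in every open cone around the limit.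
\<close>

lemma infinite_in_open_cone:
  assumes u: "u \<in> limit_cone p \<Gamma>" "u \<noteq> 0" and C: "open_cone C" "u \<in> C"
  shows "infinite {g \<in> \<Gamma>. cartan_proj p g \<in> C}"
proof
  assume fin: "finite {g \<in> \<Gamma>. cartan_proj p g \<in> C}"
  obtain t g where tg: "\<And>j. t j > 0" "\<And>j. g j \<in> \<Gamma>" and t0: "t \<longlonglongrightarrow> 0"
    and lim: "(\<lambda>j. t j *\<^sub>R cartan_proj p (g j)) \<longlonglongrightarrow> u"
    using u by (auto simp: limit_cone_def)
  define B where "B = Max (insert 0 ((\<lambda>g. norm (cartan_proj p g)) ` {g \<in> \<Gamma>. cartan_proj p g \<in> C}))"
  have "\<forall>\<^sub>F j in sequentially. t j *\<^sub>R cartan_proj p (g j) \<in> C"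
    using lim C by (intro topological_tendstoD) (auto simp: open_cone_def)
  then have "\<forall>\<^sub>F j in sequentially. norm (t j *\<^sub>R cartan_proj p (g j)) \<le> t j * B"
  proof eventually_elim
    case (elim j)
    have "inverse (t j) *\<^sub>R (t j *\<^sub>R cartan_proj p (g j)) \<in> C"
      using C elim tg(1)[of j] unfolding open_cone_def by (meson positive_imp_inverse_positive)
    then have "cartan_proj p (g j) \<in> C" using tg(1)[of j] by simp
    then have "norm (cartan_proj p (g j)) \<le> B"
      unfolding B_def using fin tg(2)[of j] by (intro Max_ge) auto
    then show ?case using tg(1)[of j] by simp
  qed
  moreover have "(\<lambda>j. t j * B) \<longlonglongrightarrow> 0" using tendsto_mult_right[OF t0, of B] by simp
  ultimately have "(\<lambda>j. t j *\<^sub>R cartan_proj p (g j)) \<longlonglongrightarrow> 0"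
    by (rule Lim_null_comparison)
  then show False using lim u(2) LIMSEQ_unique by blast
qed

text \<open>
  With the previous lemma this shows that exponents of convergence around a direction of the limit
  cone are never negative. The dimension is nonnegative by definition, so the upper bound has to
  be nonnegative too.
\<close>

lemma summable_exp_imp_pos:
  fixes f :: "'i \<Rightarrow> real"
  assumes summ: "(\<lambda>i. exp (- s * f i)) summable_on I" and "infinite I" and "\<And>i. f i \<ge> 0"
  shows "s > 0"
proof (rule ccontr)
  assume "\<not> s > 0"
  obtain F where F: "finite F" "F \<subseteq> I"
    and tail: "\<And>G. finite G \<Longrightarrow> G \<subseteq> I - F \<Longrightarrow> (\<Sum>i\<in>G. exp (- s * f i)) \<le> 1/2"
    by (rule summable_on_small_tail[OF summ, of "1/2"]) (simp, simp, rule that)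
  obtain i where "i \<in> I - F" using Diff_infinite_finite[OF F(1) \<open>infinite I\<close>] infinite_imp_nonempty by blast
  then have "exp (- s * f i) \<le> 1/2" using tail[of "{i}"] by simp
  moreover have "exp (- s * f i) \<ge> 1" using \<open>\<not> s > 0\<close> assms(3)[of i] by (simp add: mult_nonpos_nonneg)
  ultimately show False by linarith
qed

section \<open>Shadows on the Furstenberg boundary\<close>

text \<open>
  The radius of the shadowed ball is proportional to \<open>norm (cartan_proj p g)\<close> instead of constant. A
  point of the directional limit set then lies in infinitely many of these shadows, whatever its
  own bound on the distance to the orbit is, so one family of shadows covers the whole limit set;
  the enlargement costs only \<open>2 * \<alpha>\<close> in the exponent of the diameter.
\<close>

definition flat_shadow ::
  "('k::finite \<Rightarrow> nat) \<Rightarrow> 'k point \<Rightarrow> real ^ 'k \<Rightarrow> real \<Rightarrow> ('k \<Rightarrow> real mat) \<Rightarrow> 'k point set" where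
  "flat_shadow n p u \<alpha> g = {\<xi> \<in> furstenberg_bdry n. \<exists>r t. t \<ge> 0 \<and>
     (\<forall>i. geodesic_ray (n i) (p i) (\<xi> i) (r i)) \<and>
     prod_dist (\<lambda>i. r i (t * u $ i)) (prod_act g p) \<le> \<alpha> * norm (cartan_proj p g)}"

text \<open>
  A flat ray that meets the ball around the orbit point does so at a time \<open>t\<close> that differs
  from \<open>norm (cartan_proj p g)\<close> by at most the radius. In factor \<open>i\<close> the size of the shadow is
  \<open>exp (- t * u $ i)\<close> up to a factor exponential in the radius, and the factor with the smallest coordinate \<open>u $ i\<close> determines the diameter.
  This is where the division by \<open>m\<^sub>u\<close> comes from.
\<close>

lemma flat_shadow_diam:
  fixes p :: "'k::finite point"
  assumes p: "\<And>i. p i \<in> hyp_space (n i)"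
    and orbit: "\<And>i. g i *\<^sub>v p i \<in> hyp_space (n i)"
    and u: "norm u = 1" "\<And>i. m \<le> u $ i" and m: "m > 0" and \<alpha>: "\<alpha> \<ge> 0"
    and \<xi>: "\<xi> \<in> flat_shadow n p u \<alpha> g" and \<eta>: "\<eta> \<in> flat_shadow n p u \<alpha> g"
  shows "bdry_dist \<xi> \<eta>
    \<le> (\<Sum>i\<in>UNIV. 2 * pi * p i $v 0) * exp (- (m - 2 * \<alpha>) * norm (cartan_proj p g))"
proof -
  define N where "N = norm (cartan_proj p g)"
  have u0: "u $ i \<ge> 0" for i using u(2)[of i] m by simp
  have m1: "m \<le> 1" using u(2)[of undefined] component_le_norm_cart[of u undefined] u(1) by simp
  have near: "\<exists>q t. t \<ge> 0 \<and> m * N - \<alpha> * N \<le> t \<and> geodesic_ray (n i) (p i) (\<zeta> i) q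
      \<and> hyp_dist (q t) (g i *\<^sub>v p i) \<le> \<alpha> * N \<and> \<zeta> i \<in> bdry_sphere (n i)"
    if \<zeta>: "\<zeta> \<in> flat_shadow n p u \<alpha> g" for \<zeta> i
  proof -
    obtain r t where t: "t \<ge> 0" and rays: "\<And>i. geodesic_ray (n i) (p i) (\<zeta> i) (r i)"
      and le: "prod_dist (\<lambda>i. r i (t * u $ i)) (prod_act g p) \<le> \<alpha> * N"
      using \<zeta> by (auto simp: flat_shadow_def N_def)
    have "norm (cartan_proj p g - t *\<^sub>R u) \<le> \<alpha> * N"
      using cartan_proj_near_flat_ray[where n=n, OF rays orbit u0 t] le by simp
    then have tN: "N - \<alpha> * N \<le> t"
      using norm_triangle_ineq2[of "cartan_proj p g" "t *\<^sub>R u"] t u(1) by (simp add: N_def)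
    have "m * N - \<alpha> * N \<le> m * (N - \<alpha> * N)"
      using mult_right_mono[OF m1, of "\<alpha> * N"] \<alpha> by (simp add: N_def algebra_simps)
    also have "\<dots> \<le> m * t" using tN m by simp
    also have "\<dots> \<le> t * u $ i" using mult_left_mono[OF u(2)[of i] t] by (simp add: mult.commute)
    finally have tau: "m * N - \<alpha> * N \<le> t * u $ i" .
    have tu: "t * u $ i \<ge> 0" using t u0 by simp
    have "r i (t * u $ i) \<in> hyp_space (n i)"
      using rays[of i] tu by (simp add: geodesic_ray_def)
    then have "0 \<le> hyp_dist (r i (t * u $ i)) (g i *\<^sub>v p i)"
      by (rule hyp_dist_nonneg[OF _ orbit])
    then have "hyp_dist (r i (t * u $ i)) (g i *\<^sub>v p i) \<le> \<alpha> * N"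
      using hyp_dist_le_prod_dist[of "\<lambda>i. r i (t * u $ i)" i "prod_act g p"] le
      by (simp add: prod_act_def)
    then show ?thesis
      using tu tau rays[of i] \<zeta> by (auto simp: flat_shadow_def furstenberg_bdry_def)
  qed
  have comp: "sphere_dist (\<xi> i) (\<eta> i) \<le> 2 * pi * p i $v 0 * exp (- (m - 2 * \<alpha>) * N)"
    and comp_nonneg: "0 \<le> sphere_dist (\<xi> i) (\<eta> i)" for i
  proof -
    obtain q t where q: "t \<ge> 0" "m * N - \<alpha> * N \<le> t" "geodesic_ray (n i) (p i) (\<xi> i) q"
      "hyp_dist (q t) (g i *\<^sub>v p i) \<le> \<alpha> * N" "\<xi> i \<in> bdry_sphere (n i)"
      using near[OF \<xi>, of i] by blast
    obtain q' t' where q': "t' \<ge> 0" "m * N - \<alpha> * N \<le> t'" "geodesic_ray (n i) (p i) (\<eta> i) q'"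
      "hyp_dist (q' t') (g i *\<^sub>v p i) \<le> \<alpha> * N" "\<eta> i \<in> bdry_sphere (n i)"
      using near[OF \<eta>, of i] by blast
    have "sphere_dist (\<xi> i) (\<eta> i) \<le> 2 * pi * p i $v 0 * exp (\<alpha> * N - (m * N - \<alpha> * N))"
      by (rule sphere_dist_le_of_rays_near[OF q(3) q'(3) q(5) q'(5) orbit q(1,2) q'(1,2) q(4) q'(4)])
    moreover have "\<alpha> * N - (m * N - \<alpha> * N) = - (m - 2 * \<alpha>) * N" by (simp add: algebra_simps)
    ultimately show "sphere_dist (\<xi> i) (\<eta> i) \<le> 2 * pi * p i $v 0 * exp (- (m - 2 * \<alpha>) * N)"
      by simp
    show "0 \<le> sphere_dist (\<xi> i) (\<eta> i)"
      using bdry_sphere_scalar_prod_bounds[OF q(5) q'(5)]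
      by (auto simp: sphere_dist_def intro!: arccos_lbound)
  qed
  have "bdry_dist \<xi> \<eta> = L2_set (\<lambda>i. sphere_dist (\<xi> i) (\<eta> i)) UNIV"
    by (simp add: bdry_dist_def L2_set_def)
  also have "\<dots> \<le> (\<Sum>i\<in>UNIV. sphere_dist (\<xi> i) (\<eta> i))"
    by (rule L2_set_le_sum) (rule comp_nonneg)
  also have "\<dots> \<le> (\<Sum>i\<in>UNIV. 2 * pi * p i $v 0 * exp (- (m - 2 * \<alpha>) * N))"
    by (rule sum_mono) (rule comp)
  finally show ?thesis by (simp add: sum_distrib_right N_def)
qed

lemma Liminf_less_infinity_frequently:
  fixes f :: "'t \<Rightarrow> ereal"
  assumes "Liminf F f < \<infinity>"
  obtains R where "\<exists>\<^sub>F t in F. f t < ereal R"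
proof (rule ccontr)
  assume "\<not> thesis"
  then have "\<forall>\<^sub>F t in F. ereal R \<le> f t" for R
  proof -
    have "\<not> (\<exists>\<^sub>F t in F. f t < ereal R)" using that[of R] \<open>\<not> thesis\<close> by blast
    then show ?thesis by (simp add: not_frequently not_less)
  qed
  then have "ereal R \<le> Liminf F f" for R by (rule Liminf_bounded)
  then have "Liminf F f = \<infinity>" by (intro ereal_top)
  then show False using assms by simp
qed

text \<open>
  Let \<open>R\<close> bound the distance to the orbit at arbitrarily late times \<open>t\<close>. An orbit point \<open>g p\<close> seen at
  such a time has Cartan projection within \<open>R\<close> of \<open>t *\<^sub>R u\<close>; for late \<open>t\<close> this puts it in the cone
  \<open>C\<close>, makes it longer than all those of \<open>F\<close>, and makes \<open>R\<close> smaller than \<open>\<alpha>\<close> times its norm.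
\<close>

lemma directional_limit_in_flat_shadows:
  assumes orbit: "\<And>g i. g \<in> \<Gamma> \<Longrightarrow> g i *\<^sub>v p i \<in> hyp_space (n i)"
    and u: "norm u = 1" "\<And>i. 0 \<le> u $ i" and \<alpha>: "\<alpha> > 0"
    and C: "open_cone C" "u \<in> C" and F: "finite F"
    and \<xi>: "\<xi> \<in> directional_limit_set n p \<Gamma> u"
  shows "\<exists>g\<in>{g \<in> \<Gamma>. cartan_proj p g \<in> C} - F. \<xi> \<in> flat_shadow n p u \<alpha> g"
proof -
  obtain r where \<xi>b: "\<xi> \<in> furstenberg_bdry n"
    and rays: "\<And>i. geodesic_ray (n i) (p i) (\<xi> i) (r i)"
    and liminf: "Liminf at_top (\<lambda>t::real. INF g\<in>\<Gamma>.
         ereal (prod_dist (\<lambda>i. r i (t * u $ i)) (prod_act g p))) < \<infinity>"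
    using \<xi> by (auto simp: directional_limit_set_def)
  obtain R where R: "\<exists>\<^sub>F t in at_top. (INF g\<in>\<Gamma>.
         ereal (prod_dist (\<lambda>i. r i (t * u $ i)) (prod_act g p))) < ereal R"
    using Liminf_less_infinity_frequently[OF liminf] by blast
  obtain e where e: "e > 0" "ball u e \<subseteq> C" using C unfolding open_cone_def open_contains_ball by blast
  define B where "B = Max (insert 0 ((\<lambda>g. norm (cartan_proj p g)) ` F))"
  have B: "norm (cartan_proj p g) \<le> B" if "g \<in> F" for g
    unfolding B_def using F that by (intro Max_ge) auto
  \<comment> \<open>the four bounds give, in order: positivity of \<open>t\<close>, the cone \<open>C\<close>, avoiding \<open>F\<close>, and the shadow radius\<close>
  define T where "T = Max {1, R / e + 1, R + B + 1, R + R / \<alpha>}"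
  have T: "1 \<le> T" "R / e + 1 \<le> T" "R + B + 1 \<le> T" "R + R / \<alpha> \<le> T" by (simp_all add: T_def)
  have "\<exists>\<^sub>F t in at_top. T \<le> t \<and> (INF g\<in>\<Gamma>.
         ereal (prod_dist (\<lambda>i. r i (t * u $ i)) (prod_act g p))) < ereal R"
    using frequently_eventually_frequently[OF R eventually_ge_at_top[of T]]
    by (simp add: conj_commute)
  then obtain t where t: "T \<le> t" and "(INF g\<in>\<Gamma>.
         ereal (prod_dist (\<lambda>i. r i (t * u $ i)) (prod_act g p))) < ereal R"
    using frequently_ex by blast
  then obtain g where g: "g \<in> \<Gamma>" and gR: "prod_dist (\<lambda>i. r i (t * u $ i)) (prod_act g p) < R"
    by (auto simp: INF_less_iff)
  have t0: "t > 0" "R < t * e" "R + B < t" "R \<le> \<alpha> * (t - R)"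
  proof -
    show "t > 0" "R + B < t" using t T by linarith+
    have "R / e < t" using t T by linarith
    then show "R < t * e" using e by (simp add: divide_less_eq)
    have "R / \<alpha> \<le> t - R" using t T by linarith
    then show "R \<le> \<alpha> * (t - R)" using \<alpha> by (simp add: divide_le_eq mult.commute)
  qed
  define v where "v = cartan_proj p g"
  have "norm (v - t *\<^sub>R u) \<le> prod_dist (\<lambda>i. r i (t * u $ i)) (prod_act g p)"
    unfolding v_def
    by (rule cartan_proj_near_flat_ray[where n=n, OF rays]) (use orbit g u t0 in auto)
  then have vR: "norm (v - t *\<^sub>R u) < R" using gR by linarith
  have Nv: "t - R \<le> norm v"
    using norm_triangle_ineq2[of "t *\<^sub>R u" v] vR t0 u(1) by (simp add: norm_minus_commute)
  have "norm (inverse t *\<^sub>R v - u) = norm (inverse t *\<^sub>R (v - t *\<^sub>R u))"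
    using t0 by (simp add: algebra_simps)
  also have "\<dots> = norm (v - t *\<^sub>R u) / t" using t0 by (simp add: divide_inverse mult.commute)
  also have "\<dots> < e" using vR t0 by (simp add: divide_less_eq mult.commute)
  finally have "inverse t *\<^sub>R v \<in> C" using e by (auto simp: dist_norm norm_minus_commute)
  then have "t *\<^sub>R (inverse t *\<^sub>R v) \<in> C" using C t0 unfolding open_cone_def by blast
  then have "v \<in> C" using t0 by simp
  moreover have "g \<notin> F" using B[of g] Nv t0 by (auto simp: v_def)
  moreover have "R \<le> \<alpha> * norm v"
    using t0(4) mult_left_mono[OF Nv, of \<alpha>] \<alpha> by linarith
  then have "prod_dist (\<lambda>i. r i (t * u $ i)) (prod_act g p) \<le> \<alpha> * norm (cartan_proj p g)"
    using gR by (simp add: v_def)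
  then have "\<xi> \<in> flat_shadow n p u \<alpha> g"
    unfolding flat_shadow_def using \<xi>b rays less_imp_le[OF t0(1)] by blast
  ultimately show ?thesis using g by (auto simp: v_def)
qed

section \<open>The dimension bound\<close>

text \<open>
  For \<open>s > \<delta>\<^sub>u / m\<^sub>u\<close> some cone around \<open>u\<close> has a convergent series with an exponent \<open>s' < s * m\<^sub>u\<close>. The
  shadows of the orbit points in that cone cover the limit set infinitely often, and the
  \<open>s\<close>-th powers of their diameters are bounded by a multiple of the terms of that series.
\<close>

theorem dim_directional_limit_set_le:
  fixes p :: "'k::finite point"
  assumes p: "\<And>i. p i \<in> hyp_space (n i)"
    and orbit: "\<And>g i. g \<in> \<Gamma> \<Longrightarrow> g i *\<^sub>v p i \<in> hyp_space (n i)"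
    and u: "norm u = 1" "u \<in> limit_cone p \<Gamma>" and pos: "\<And>i. 0 < u $ i"
  shows "hausdorff_dim (furstenberg_bdry n) bdry_dist (directional_limit_set n p \<Gamma> u)
         \<le> growth_indicator p \<Gamma> u / ereal (Min (range (\<lambda>i. u $ i)))"
proof -
  define m where "m = Min (range (\<lambda>i. u $ i))"
  have m: "m > 0" "\<And>i. m \<le> u $ i" using pos by (auto simp: m_def)
  have u0: "u \<noteq> 0" using u by auto
  define \<psi> where "\<psi> = growth_indicator p \<Gamma> u"
  have \<psi>: "\<psi> = (INF C\<in>{C. open_cone C \<and> u \<in> C}. cone_exponent p \<Gamma> C)"
    using u u0 by (simp add: \<psi>_def growth_indicator_def)
  define K where "K = (\<Sum>i\<in>UNIV. 2 * pi * p i $v 0)"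
  have K: "K > 0" unfolding K_def
    using p by (intro sum_pos) (auto simp: hyp_space_def)
  have "hausdorff_dim (furstenberg_bdry n) bdry_dist (directional_limit_set n p \<Gamma> u) \<le> y"
    if y: "\<psi> / ereal m < y" for y
  proof (cases y)
    case (real s)
    have "\<psi> < ereal (s * m)"
      using y m(1) real ereal_divide_less_pos[of "ereal m" \<psi> y] by (simp add: mult.commute)
    then obtain C where C: "open_cone C" "u \<in> C" and "cone_exponent p \<Gamma> C < ereal (s * m)"
      by (auto simp: \<psi> INF_less_iff)
    then obtain s' where s': "s' < s * m" and summ:
      "(\<lambda>g. exp (- s' * prod_dist (prod_act g p) p)) summable_on {g \<in> \<Gamma>. cartan_proj p g \<in> C}"
      by (auto simp: cone_exponent_def Inf_less_iff)
    define I where "I = {g \<in> \<Gamma>. cartan_proj p g \<in> C}"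
    have summ': "(\<lambda>g. exp (- s' * norm (cartan_proj p g))) summable_on I"
      using summ by (simp add: I_def norm_cartan_proj)
    have "s' > 0"
      by (rule summable_exp_imp_pos[OF summ']) (use infinite_in_open_cone[OF u(2) u0 C] in \<open>auto simp: I_def\<close>)
    then have s: "s > 0" using s' m(1) by (meson less_trans zero_less_mult_pos2)
    \<comment> \<open>the gap \<open>s' < s * m\<close> pays for the linearly growing radii: this \<open>\<alpha>\<close> turns the \<open>s\<close>-th powers into terms of exponent \<open>s'\<close>\<close>
    define \<alpha> where "\<alpha> = (m - s' / s) / 2"
    have \<alpha>: "\<alpha> > 0" using s' s by (simp add: \<alpha>_def divide_less_eq mult.commute)
    have \<alpha>s: "(m - 2 * \<alpha>) * s = s'"
    proof -
      have "m - 2 * \<alpha> = s' / s" by (simp add: \<alpha>_def field_simps)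
      then show ?thesis using s by simp
    qed
    define w where "w g = K * exp (- (m - 2 * \<alpha>) * norm (cartan_proj p g))" for g
    have w_powr: "w g powr s = K powr s * exp (- s' * norm (cartan_proj p g))" for g
    proof -
      have "exp (- (m - 2 * \<alpha>) * norm (cartan_proj p g)) powr s
          = exp (- ((m - 2 * \<alpha>) * s) * norm (cartan_proj p g))"
        by (simp add: powr_def algebra_simps)
      then show ?thesis using K by (simp add: w_def powr_mult \<alpha>s)
    qed
    have "hausdorff_measure (furstenberg_bdry n) bdry_dist s (directional_limit_set n p \<Gamma> u) = 0"
    proof (rule hausdorff_null_if_limsup_cover[where U = "flat_shadow n p u \<alpha>" and w = w and I = I])
      show "(\<lambda>g. w g powr s) summable_on I"
        unfolding w_powr by (rule summable_on_cmult_right[OF summ'])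
      show "bdry_dist x y \<ge> 0" for x y :: "'k point" by (simp add: bdry_dist_def sum_nonneg)
      show "flat_shadow n p u \<alpha> g \<subseteq> furstenberg_bdry n" for g by (auto simp: flat_shadow_def)
      show "bdry_dist x y \<le> w g" if "g \<in> I" "x \<in> flat_shadow n p u \<alpha> g" "y \<in> flat_shadow n p u \<alpha> g" for g x y
        unfolding w_def K_def
        by (rule flat_shadow_diam[where u=u]) (use p orbit u m \<alpha> that in \<open>auto simp: I_def\<close>)
      show "\<exists>g\<in>I - F. x \<in> flat_shadow n p u \<alpha> g"
        if "finite F" "x \<in> directional_limit_set n p \<Gamma> u" for F x
        unfolding I_def
        by (rule directional_limit_in_flat_shadows[OF _ u(1) _ \<alpha> C that])
          (rule orbit, assumption, rule less_imp_le[OF pos])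
    qed (use s K in \<open>auto simp: w_def\<close>)
    then show ?thesis unfolding hausdorff_dim_def real using s by (intro Inf_lower) blast
  qed (use y in auto)
  then have "hausdorff_dim (furstenberg_bdry n) bdry_dist (directional_limit_set n p \<Gamma> u) \<le> \<psi> / ereal m"
    by (rule dense_ge)
  then show ?thesis by (simp only: \<psi>_def m_def)
qed

theorem theorem5p2:
  fixes D :: "('a, 'b) monoid_scheme"
    and n :: "'k::finite \<Rightarrow> nat"
    and \<rho> :: "'k \<Rightarrow> 'a \<Rightarrow> real mat"
    and p :: "'k \<Rightarrow> real Matrix.vec"
    and u :: "real ^ 'k"
  assumes "finitely_generated_group D"
    and "\<And>i. n i \<ge> 2"
    and "\<And>i. p i \<in> hyp_space (n i)"
    and "\<And>i. \<rho> i \<in> hom D (SO_circ (n i))"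
    and "\<And>i. inj_on (\<rho> i) (carrier D)"
    and "\<And>i. convex_cocompact (n i) (\<rho> i ` carrier D)"
    and "\<And>i. zariski_dense_SO (n i) (\<rho> i ` carrier D)"
    and "\<And>i j. i \<noteq> j \<Longrightarrow> \<not> conjugate_reps D (n i) (\<rho> i) (n j) (\<rho> j)"
    and "norm u = 1"
    and "u \<in> interior (limit_cone p (self_joining D \<rho>))"
  shows "hausdorff_dim (furstenberg_bdry n) bdry_dist
           (directional_limit_set n p (self_joining D \<rho>) u)
         \<le> growth_indicator p (self_joining D \<rho>) u / ereal (Min (range (\<lambda>i. u $ i)))"
proof (rule dim_directional_limit_set_le)
  show orbit: "g i *\<^sub>v p i \<in> hyp_space (n i)" if g: "g \<in> self_joining D \<rho>" for g i
  proof -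
    obtain \<sigma> where "\<sigma> \<in> carrier D" "g i = \<rho> i \<sigma>" using g by (auto simp: self_joining_def)
    then show ?thesis
      using SO_circ_preserves_hyp_space assms(3) hom_in_carrier[OF assms(4)] by metis
  qed
  show "0 < u $ i" for i
    by (rule interior_orthant_pos[OF assms(10)], erule limit_cone_nonneg)
      (rule hyp_dist_nonneg[OF orbit assms(3)])
  show "u \<in> limit_cone p (self_joining D \<rho>)" using assms(10) interior_subset by blast
qed (use assms in auto)

end
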